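(* Let $n\ge2$, let $\overline H\subset H$ be the torus of $SL_n$ consisting of diagonal matrices of determinant 1, and $\overline{\mathfrak h}$ its Lie algebra. The restriction to $\overline H_{\mathrm{reg}}$ of the trigonometric Casimir connection of $\mathfrak{gl}_n$, $$\nabla=d-\sum_{i<j}\frac{d(\theta_i-\theta_j)}{e^{\theta_i-\theta_j}-1}\,\kappa_{\theta_i-\theta_j}-\sum_{i=1}^nd\theta_i\,D_i,\qquad D_i=2t_{ii}^{(2)}-\sum_{j<i}\kappa_{\theta_j-\theta_i}-E_{ii}^2,$$ takes values in $Y(\mathfrak{sl}_n)\subset Y(\mathfrak{gl}_n)$ and is equal to the sum of the trigonometric Casimir connection of $\mathfrak{sl}_n$, $$d-\sum_{i<j}\frac{d(\theta_i-\theta_j)}{e^{\theta_i-\theta_j}-1}\,\kappa_{\theta_i-\theta_j}+2\sum_{i=1}^{n-1}d\lambda_i\Big(T_{i,1}-\frac12T_{i,0}^2\Big),$$ with the $\overline{\mathfrak h}$-valued closed one-form $$-\sum_{i=1}^{n-1}d\lambda_i\,(E_{ii}-E_{i+1,i+1}),$$ where $\lambda_1,\dots,\lambda_{n-1}$ are the fundamental weights of $\mathfrak{sl}_n$.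
   Context: $Y(\mathfrak{gl}_n)$ is the unital associative $\mathbb C$-algebra generated by $t_{ij}^{(r)}$, $1\le i,j\le n$, $r\ge1$, with relations $[t_{ij}^{(r+1)},t_{kl}^{(s)}]-[t_{ij}^{(r)},t_{kl}^{(s+1)}]=t_{kj}^{(r)}t_{il}^{(s)}-t_{kj}^{(s)}t_{il}^{(r)}$ for $r,s\in\mathbb N=\{0,1,\dots\}$, where $t_{ij}^{(0)}=\delta_{ij}$. $\mathfrak{gl}_n\subset Y(\mathfrak{gl}_n)$ via $E_{ij}\mapsto t_{ij}^{(1)}$. $\theta_a(E_{bb})=\delta_{ab}$; $\kappa_{\theta_a-\theta_b}=E_{ab}E_{ba}+E_{ba}E_{ab}$. $H\subset GL_n$ is the torus of diagonal matrices, $e^{\theta_a}$ the $a$-th diagonal entry, and $\overline H_{\mathrm{reg}}\subset\overline H$ the subset of matrices with distinct diagonal entries; $d\theta_a$, $d\lambda_i$ are translation-invariant one-forms, $\{\lambda_i\}$ being the basis of $\overline{\mathfrak h}^*$ dual to $\{E_{ii}-E_{i+1,i+1}\}_{i=1}^{n-1}$. Let $T(u)=(t_{ij}(u))$, $t_{ij}(u)=\sum_{r\ge0}t_{ij}^{(r)}u^{-r}$, and let $T(u)=F(u)H(u)E(u)$ be its Gauss decomposition with $F(u)$ lower unipotent, $E(u)$ upper unipotent and $H(u)$ diagonal with entries $h_1(u),\dots,h_n(u)\in1+u^{-1}Y(\mathfrak{gl}_n)[[u^{-1}]]$. $Y(\mathfrak{sl}_n)\subset Y(\mathfrak{gl}_n)$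 is the subalgebra of elements fixed by all automorphisms $T(u)\mapsto f(u)T(u)$, $f\in1+u^{-1}\mathbb C[[u^{-1}]]$. The Cartan loop generators $T_{i,r}$ ($1\le i\le n-1$, $r\ge0$) of $Y(\mathfrak{sl}_n)$ in Drinfeld's new realisation (with $\hbar=1$, the trace form, and $t_i=\alpha_i^\vee$) are given by $1+\sum_{r\ge0}T_{i,r}u^{-r-1}=h_i\big(u-\tfrac{i-1}2\big)^{-1}h_{i+1}\big(u-\tfrac{i-1}2\big)$; in particular $T_{i,0}=-(E_{ii}-E_{i+1,i+1})$. The trigonometric Casimir connection of a simple Lie algebra $\mathfrak g$ is in general $d-\hbar\sum_{\alpha>0}\frac{d\alpha}{e^\alpha-1}\kappa_\alpha+2\sum_idu_i\big(T(u^i)_1-\frac\hbar2\sum_j(u^i,t^j)t_j^2\big)$, with $\{u_i\},\{u^i\}$ dual bases of $\mathfrak h^*,\mathfrak h$, $T(u)_1=\sum_j(u,t^j)T_{j,1}$, $t_j$ corresponding to $T_{j,0}$ and $t^j$ the fundamental coweights; the expression in the claim is this connection for $u_i=\lambda_i$, $u^i=E_{ii}-E_{i+1,i+1}$. *)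

theory Defs
  imports Complex_Main "HOL-Library.Cardinality" "HOL-Library.Poly_Mapping"
    "HOL-Computational_Algebra.Formal_Power_Series"
begin

section \<open>Free associative algebras\<close>

text \<open>
  The free unital associative complex algebra on \<open>'g\<close> is the monoid algebra of the free monoid
  on \<open>'g\<close>.  The library's monoid algebra is written for additive monoids, hence the
  \<open>monoid_add\<close> instance on words.
\<close>

datatype 'g free_mon = Mon (letters: "'g list")

instantiation free_mon :: (type) monoid_add
begin

definition zero_free_mon :: "'g free_mon" where
  "zero_free_mon = Mon []"

definition plus_free_mon :: "'g free_mon \<Rightarrow> 'g free_mon \<Rightarrow> 'g free_mon" where
  "plus_free_mon v w = Mon (letters v @ letters w)"

instance
  by standard (auto simp: zero_free_mon_def plus_free_mon_def)

end

type_synonym 'g free_alg = "'g free_mon \<Rightarrow>\<^sub>0 complex"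

definition free_gen :: "'g \<Rightarrow> 'g free_alg" where
  "free_gen g = Poly_Mapping.single (Mon [g]) 1"

definition free_const :: "complex \<Rightarrow> 'g free_alg" where
  "free_const c = Poly_Mapping.single 0 c"

lemma free_const_simps:
  "free_const 0 = 0" "free_const 1 = 1"
  "free_const (c + d) = free_const c + free_const d"
  "free_const (c * d) = free_const c * free_const d"
  by (simp_all add: free_const_def single_add mult_single)

lemma lookup_free_const_mult:
  fixes w :: "'g free_mon"
  shows "Poly_Mapping.lookup (free_const c * p) w = c * Poly_Mapping.lookup p w"
proof -
  have "Poly_Mapping.lookup (free_const c * p) w
      = Sum_any (\<lambda>l. (c * Sum_any (\<lambda>q. Poly_Mapping.lookup p q when w = q)) when l = (0 :: 'g free_mon))"
    unfolding lookup_mult free_const_def lookup_single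
    by (rule Sum_any.cong) (auto simp: when_def)
  also have "\<dots> = c * Poly_Mapping.lookup p w"
    by simp
  finally show ?thesis .
qed

lemma lookup_mult_free_const:
  fixes w :: "'g free_mon"
  shows "Poly_Mapping.lookup (p * free_const c) w = Poly_Mapping.lookup p w * c"
proof -
  have *: "((c when 0 = q) when w = l + q) = ((c when w = l) when q = 0)" for l q :: "'g free_mon"
    by (auto simp: when_def)
  have "Poly_Mapping.lookup (p * free_const c) w
      = Sum_any (\<lambda>l. Poly_Mapping.lookup p l * Sum_any (\<lambda>q. (c when w = l) when q = (0 :: 'g free_mon)))"
    unfolding lookup_mult free_const_def lookup_single * by (rule refl)
  also have "\<dots> = Sum_any (\<lambda>l. (Poly_Mapping.lookup p w * c) when l = w)"
    by (rule Sum_any.cong) (auto simp: when_def)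
  finally show ?thesis by simp
qed

lemma free_const_central: "free_const c * p = p * free_const c"
  by (rule poly_mapping_eqI)
    (simp add: lookup_free_const_mult lookup_mult_free_const mult.commute)

lemma lookup_mult_0:
  "Poly_Mapping.lookup (p * q) 0 = Poly_Mapping.lookup p 0 * Poly_Mapping.lookup q (0 :: 'g free_mon)"
proof -
  have *: "0 = v + w \<longleftrightarrow> v = 0 \<and> w = 0" for v w :: "'g free_mon"
    by (cases v; cases w) (auto simp: zero_free_mon_def plus_free_mon_def)
  have "Poly_Mapping.lookup (p * q) 0
      = Sum_any (\<lambda>l. (Poly_Mapping.lookup p l * Sum_any (\<lambda>k. Poly_Mapping.lookup q k when k = 0)) when l = 0)"
    unfolding lookup_mult * by (rule Sum_any.cong) (auto simp: when_def)
  also have "\<dots> = Poly_Mapping.lookup p 0 * Poly_Mapping.lookup q 0"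
    by simp
  finally show ?thesis .
qed


section \<open>The Yangian of \<open>gl\<^sub>n\<close>\<close>

text \<open>
  The rank is carried by a finite type: \<open>n = CARD('n)\<close>.  Indices are the natural numbers
  \<open>1, \<dots>, n\<close>, and \<open>'n ysym\<close> is the set of symbols \<open>t\<^sub>i\<^sub>j\<^sup>(\<^sup>r\<^sup>)\<close> with \<open>1 \<le> i, j \<le> n\<close>, \<open>r \<ge> 1\<close>.
\<close>

typedef ('n :: finite) ysym =
  "{1..CARD('n)} \<times> {1..CARD('n)} \<times> {r :: nat. 1 \<le> r}"
  by (rule exI[of _ "(1, 1, 1)"]) (auto simp: Suc_le_eq)

definition ft :: "nat \<Rightarrow> nat \<Rightarrow> nat \<Rightarrow> ('n :: finite) ysym free_alg" where
  "ft i j r = (if r = 0 then if i = j then 1 else 0 else free_gen (Abs_ysym (i, j, r)))"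

inductive_set yideal :: "('n :: finite) ysym free_alg set" where
  rel: "\<lbrakk>i \<in> {1..CARD('n)}; j \<in> {1..CARD('n)}; k \<in> {1..CARD('n)}; l \<in> {1..CARD('n)}\<rbrakk> \<Longrightarrow>
    (ft i j (r + 1) * ft k l s - ft k l s * ft i j (r + 1))
    - (ft i j r * ft k l (s + 1) - ft k l (s + 1) * ft i j r)
    - (ft k j r * ft i l s - ft k j s * ft i l r) \<in> yideal"
| zero: "0 \<in> yideal"
| add: "\<lbrakk>p \<in> yideal; q \<in> yideal\<rbrakk> \<Longrightarrow> p + q \<in> yideal"
| mult_left: "p \<in> yideal \<Longrightarrow> a * p \<in> yideal"
| mult_right: "p \<in> yideal \<Longrightarrow> p * a \<in> yideal"

lemma yideal_uminus: "p \<in> yideal \<Longrightarrow> - p \<in> yideal"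
  using yideal.mult_left[of p "- 1"] by simp

lemma yideal_diff: "\<lbrakk>p \<in> yideal; q \<in> yideal\<rbrakk> \<Longrightarrow> p - q \<in> yideal"
  using yideal.add[of p "- q"] yideal_uminus[of q] by simp

lemma yideal_augmentation:
  fixes p :: "('n :: finite) ysym free_alg"
  shows "p \<in> yideal \<Longrightarrow> Poly_Mapping.lookup p 0 = 0"
proof (induction rule: yideal.induct)
  case (rel i j k l r s)
  have "Poly_Mapping.lookup (ft i j r :: 'n ysym free_alg) 0 = (if r = 0 \<and> i = j then 1 else 0)" for i j r
    by (auto simp: ft_def free_gen_def lookup_single zero_free_mon_def when_def lookup_one)
  then show ?case
    unfolding lookup_minus lookup_mult_0 by (cases "r = 0"; cases "s = 0") simp_all
qed (auto simp: lookup_add lookup_mult_0)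

quotient_type 'n yangian =
  "('n :: finite) ysym free_alg" / "\<lambda>p q. p - q \<in> (yideal :: 'n ysym free_alg set)"
proof (rule equivpI)
  show "reflp (\<lambda>p q. p - q \<in> (yideal :: 'n ysym free_alg set))"
    by (rule reflpI) (simp add: yideal.zero)
  show "symp (\<lambda>p q. p - q \<in> (yideal :: 'n ysym free_alg set))"
    by (metis (no_types, lifting) minus_diff_eq sympI yideal_uminus)
  show "transp (\<lambda>p q. p - q \<in> (yideal :: 'n ysym free_alg set))"
    by (metis (no_types, lifting) diff_add_cancel add_diff_eq transpI yideal.add)
qed

instantiation yangian :: (finite) ring_1
begin

lift_definition zero_yangian :: "'a yangian" is 0 .

lift_definition one_yangian :: "'a yangian" is 1 .

lift_definition plus_yangian :: "'a yangian \<Rightarrow> 'a yangian \<Rightarrow> 'a yangian" is "(+)"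
proof -
  fix p q r s :: "'a ysym free_alg"
  assume "p - q \<in> yideal" "r - s \<in> yideal"
  then have "(p - q) + (r - s) \<in> yideal" by (rule yideal.add)
  then show "p + r - (q + s) \<in> yideal" by (simp only: add_diff_add)
qed

lift_definition uminus_yangian :: "'a yangian \<Rightarrow> 'a yangian" is uminus
proof -
  fix p q :: "'a ysym free_alg"
  assume "p - q \<in> yideal"
  then have "- (p - q) \<in> yideal" by (rule yideal_uminus)
  then show "- p - - q \<in> yideal" by simp
qed

lift_definition minus_yangian :: "'a yangian \<Rightarrow> 'a yangian \<Rightarrow> 'a yangian" is "(-)"
proof -
  fix p q r s :: "'a ysym free_alg"
  assume "p - q \<in> yideal" "r - s \<in> yideal"
  then have "(p - q) - (r - s) \<in> yideal" by (rule yideal_diff)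
  moreover have "(p - q) - (r - s) = p - r - (q - s)" by simp
  ultimately show "p - r - (q - s) \<in> yideal" by (simp only:)
qed

lift_definition times_yangian :: "'a yangian \<Rightarrow> 'a yangian \<Rightarrow> 'a yangian" is "(*)"
proof -
  fix p q r s :: "'a ysym free_alg"
  assume "p - q \<in> yideal" "r - s \<in> yideal"
  then have "(p - q) * r + q * (r - s) \<in> yideal"
    by (intro yideal.add yideal.mult_left yideal.mult_right)
  moreover have "(p - q) * r + q * (r - s) = p * r - q * s" by (simp add: algebra_simps)
  ultimately show "p * r - q * s \<in> yideal" by (simp only:)
qed

instance
proof
  have "(1 :: 'a ysym free_alg) \<notin> yideal"
    using yideal_augmentation[of "1 :: 'a ysym free_alg"] by (auto simp: lookup_one)
  then have "(0 :: 'a ysym free_alg) - 1 \<notin> yideal"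
    using yideal_uminus[of "0 - 1 :: 'a ysym free_alg"] by auto
  then show "(0 :: 'a yangian) \<noteq> 1"
    by transfer
qed (transfer, simp add: algebra_simps yideal.zero)+

end

lift_definition yconst :: "complex \<Rightarrow> ('n :: finite) yangian" is free_const .

definition yscale :: "complex \<Rightarrow> ('n :: finite) yangian \<Rightarrow> 'n yangian" (infixr \<open>*\<^sub>Y\<close> 75) where
  "c *\<^sub>Y x = yconst c * x"

lemma yconst_simps:
  "yconst 0 = 0" "yconst 1 = 1"
  "yconst (c + d) = yconst c + yconst d" "yconst (c * d) = yconst c * yconst d"
  by (transfer; simp add: free_const_simps yideal.zero)+

lemma yconst_central: "yconst c * x = x * yconst c"
  by transfer (simp add: free_const_central yideal.zero)

lemma yangian_complex_algebra:
  "vector_space ((*\<^sub>Y) :: complex \<Rightarrow> ('n :: finite) yangian \<Rightarrow> 'n yangian)"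
  "(c *\<^sub>Y x) * y = c *\<^sub>Y (x * y)" "x * (c *\<^sub>Y y) = c *\<^sub>Y (x * y)"
proof -
  show "vector_space ((*\<^sub>Y) :: complex \<Rightarrow> 'n yangian \<Rightarrow> 'n yangian)"
    by unfold_locales (simp_all add: yscale_def yconst_simps algebra_simps)
  show "(c *\<^sub>Y x) * y = c *\<^sub>Y (x * y)"
    by (simp add: yscale_def mult.assoc)
  show "x * (c *\<^sub>Y y) = c *\<^sub>Y (x * y)"
    by (metis yscale_def yconst_central mult.assoc)
qed

text \<open>
  \<open>ygen i j r\<close> is \<open>t\<^sub>i\<^sub>j\<^sup>(\<^sup>r\<^sup>)\<close>, with \<open>t\<^sub>i\<^sub>j\<^sup>(\<^sup>0\<^sup>) = \<delta>\<^sub>i\<^sub>j\<close>; it is meaningful for \<open>i, j \<in> {1..CARD('n)}\<close> only.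
\<close>

lift_definition ygen :: "nat \<Rightarrow> nat \<Rightarrow> nat \<Rightarrow> ('n :: finite) yangian" is ft .

lemma ygen_relation:
  assumes "i \<in> {1..CARD('n)}" "j \<in> {1..CARD('n)}" "k \<in> {1..CARD('n)}" "l \<in> {1..CARD('n)}"
  shows "(ygen i j (r + 1) * ygen k l s - ygen k l s * ygen i j (r + 1))
    - (ygen i j r * ygen k l (s + 1) - ygen k l (s + 1) * ygen i j r)
    = ygen k j r * ygen i l s - ygen k j s * (ygen i l r :: ('n :: finite) yangian)"
  using assms by transfer (rule yideal.rel)

definition yE :: "nat \<Rightarrow> nat \<Rightarrow> ('n :: finite) yangian" where
  "yE i j = ygen i j 1"

definition kappa :: "nat \<Rightarrow> nat \<Rightarrow> ('n :: finite) yangian" where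
  "kappa a b = yE a b * yE b a + yE b a * yE a b"


section \<open>The subalgebra \<open>Y(sl\<^sub>n)\<close>\<close>

text \<open>Power series in \<open>u\<^sup>-\<^sup>1\<close> are formal power series whose variable stands for \<open>u\<^sup>-\<^sup>1\<close>.\<close>

definition yalg_automorphism :: "(('n :: finite) yangian \<Rightarrow> 'n yangian) \<Rightarrow> bool" where
  "yalg_automorphism \<phi> \<longleftrightarrow> bij \<phi> \<and> \<phi> 1 = 1 \<and> (\<forall>x y. \<phi> (x + y) = \<phi> x + \<phi> y) \<and>
     (\<forall>x y. \<phi> (x * y) = \<phi> x * \<phi> y) \<and> (\<forall>c x. \<phi> (c *\<^sub>Y x) = c *\<^sub>Y \<phi> x)"

text \<open>\<open>T(u) \<mapsto> f(u) T(u)\<close>, read off coefficientwise.\<close>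

definition multiplies_T_by :: "complex fps \<Rightarrow> (('n :: finite) yangian \<Rightarrow> 'n yangian) \<Rightarrow> bool" where
  "multiplies_T_by f \<phi> \<longleftrightarrow> (\<forall>i\<in>{1..CARD('n)}. \<forall>j\<in>{1..CARD('n)}. \<forall>r.
     \<phi> (ygen i j r) = (\<Sum>s\<le>r. fps_nth f s *\<^sub>Y ygen i j (r - s)))"

definition yangian_sl :: "('n :: finite) yangian set" where
  "yangian_sl = {x. \<forall>f \<phi>. fps_nth f 0 = 1 \<and> yalg_automorphism \<phi> \<and> multiplies_T_by f \<phi> \<longrightarrow> \<phi> x = x}"


section \<open>Gauss decomposition\<close>

definition gauss_decomposition ::
  "nat \<Rightarrow> (nat \<Rightarrow> nat \<Rightarrow> 'a fps) \<Rightarrow> (nat \<Rightarrow> nat \<Rightarrow> 'a fps) \<Rightarrow> (nat \<Rightarrow> 'a fps) \<Rightarrow>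
   (nat \<Rightarrow> nat \<Rightarrow> 'a :: ring_1 fps) \<Rightarrow> bool" where
  "gauss_decomposition n T F H E \<longleftrightarrow>
     (\<forall>i\<in>{1..n}. F i i = 1 \<and> E i i = 1 \<and> fps_nth (H i) 0 = 1) \<and>
     (\<forall>i\<in>{1..n}. \<forall>j\<in>{1..n}. i < j \<longrightarrow> F i j = 0 \<and> E j i = 0) \<and>
     (\<forall>i\<in>{1..n}. \<forall>j\<in>{1..n}. T i j = (\<Sum>k=1..n. F i k * H k * E k j))"

text \<open>Schur complements; they give existence and uniqueness of the Gauss decomposition.\<close>

fun schur :: "(nat \<Rightarrow> nat \<Rightarrow> 'a fps) \<Rightarrow> nat \<Rightarrow> nat \<Rightarrow> nat \<Rightarrow> 'a :: ring_1 fps" where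
  "schur T 0 i j = T i j"
| "schur T (Suc m) i j =
     (if m = 0 then T i j
      else schur T m i j - schur T m i m * fps_left_inverse (schur T m m m) 1 * schur T m m j)"

lemma fps_unit_inverse:
  fixes f :: "'a :: ring_1 fps"
  assumes "fps_nth f 0 = 1"
  shows "fps_left_inverse f 1 * f = 1" "f * fps_left_inverse f 1 = 1"
  using fps_left_inverse'[of 1 f 1] fps_right_inverse'[of 1 f 1] fps_left_inverse[of 1 f] assms
  by simp_all

lemma schur_nth_0:
  assumes "\<And>i j. \<lbrakk>i \<in> {1..n}; j \<in> {1..n}\<rbrakk> \<Longrightarrow> fps_nth (T i j) 0 = (if i = j then 1 else 0)"
    and "1 \<le> m" "m \<le> i" "m \<le> j" "i \<le> n" "j \<le> n"
  shows "fps_nth (schur T m i j) 0 = (if i = j then 1 else 0)"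
  using assms(2-)
proof (induction m arbitrary: i j)
  case (Suc m)
  then show ?case
    using assms(1)[of i j] by (cases "m = 0") auto
qed simp

lemma gauss_decomposition_exists:
  assumes T0: "\<And>i j. \<lbrakk>i \<in> {1..n}; j \<in> {1..n}\<rbrakk> \<Longrightarrow> fps_nth (T i j) 0 = (if i = j then 1 else 0)"
  shows "gauss_decomposition n T
    (\<lambda>i m. if i < m then 0 else if i = m then 1 else schur T m i m * fps_left_inverse (schur T m m m) 1)
    (\<lambda>m. schur T m m m)
    (\<lambda>m j. if j < m then 0 else if j = m then 1 else fps_left_inverse (schur T m m m) 1 * schur T m m j)"
    (is "gauss_decomposition n T ?F ?H ?E")
proof -
  let ?I = "\<lambda>m. fps_left_inverse (schur T m m m) 1"
  have inv: "?I m * ?H m = 1" "?H m * ?I m = 1" if "m \<in> {1..n}" for m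
    using that schur_nth_0[of n T m m m, OF T0] by (auto intro!: fps_unit_inverse)
  have FH: "?F i m * ?H m = schur T m i m" if "m \<in> {1..n}" "m \<le> i" for i m
    using inv[OF that(1)] that(2) by (auto simp: mult.assoc)
  have FHE: "?F i m * ?H m * ?E m j = schur T m i m * ?I m * schur T m m j"
    if "m \<in> {1..n}" "m \<le> i" "m \<le> j" for i m j
    using inv[OF that(1)] that(3) by (subst FH[OF that(1,2)]) (auto simp: mult.assoc)
  have part: "T i j = schur T (Suc m) i j + (\<Sum>k=1..m. ?F i k * ?H k * ?E k j)"
    if "m < i" "m < j" "i \<le> n" "j \<le> n" for m i j
    using that
  proof (induction m)
    case (Suc m)
    then show ?case
      using FHE[of "Suc m" i j] by (simp del: schur.simps add: schur.simps(2)[of T "Suc m"])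
  qed simp
  have "T i j = (\<Sum>k=1..n. ?F i k * ?H k * ?E k j)" if "i \<in> {1..n}" "j \<in> {1..n}" for i j
  proof -
    define m where "m = min i j"
    have m: "m \<in> {1..n}" "m \<le> i" "m \<le> j" "m = i \<or> m = j"
      using that by (auto simp: m_def)
    then obtain m' where m': "m = Suc m'"
      by (cases m) auto
    define t where "t = (\<lambda>k. ?F i k * ?H k * ?E k j)"
    have "T i j = schur T m i j + (\<Sum>k=1..m'. t k)"
      unfolding t_def m' by (rule part) (use m that m' in auto)
    moreover have "schur T m i j = schur T m i m * ?I m * schur T m m j"
      using m(4) inv[OF m(1)] by (metis mult.assoc mult_1_left mult_1_right)
    then have "schur T m i j = t m"
      unfolding t_def by (subst FHE[OF m(1-3)])
    ultimately have "T i j = (\<Sum>k=1..m. ?F i k * ?H k * ?E k j)"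
      unfolding t_def[symmetric] by (simp add: m' add.commute)
    also have "\<dots> = (\<Sum>k=1..n. ?F i k * ?H k * ?E k j)"
      using m by (intro sum.mono_neutral_left) auto
    finally show ?thesis .
  qed
  then show ?thesis
    using schur_nth_0[of n T, OF T0] unfolding gauss_decomposition_def by auto
qed

lemma gauss_decomposition_diag:
  assumes G: "gauss_decomposition n T F H E" and "m \<in> {1..n}"
  shows "H m = schur T m m m"
proof -
  have FE: "\<And>i. i \<in> {1..n} \<Longrightarrow> F i i = 1 \<and> E i i = 1 \<and> fps_nth (H i) 0 = 1"
    "\<And>i j. \<lbrakk>i \<in> {1..n}; j \<in> {1..n}; i < j\<rbrakk> \<Longrightarrow> F i j = 0 \<and> E j i = 0"
    using G by (auto simp: gauss_decomposition_def)
  have diag: "H m = schur T m m m \<and> (\<forall>i\<in>{m..n}. F i m * H m = schur T m i m) \<and>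
      (\<forall>j\<in>{m..n}. H m * E m j = schur T m m j)"
    if S: "\<forall>i\<in>{m..n}. \<forall>j\<in>{m..n}. schur T m i j = (\<Sum>k=m..n. F i k * H k * E k j)"
      and m: "m \<in> {1..n}" for m
  proof -
    have 1: "schur T m i m = F i m * H m" if "i \<in> {m..n}" for i
    proof -
      have "schur T m i m = (\<Sum>k=m..n. F i k * H k * E k m)"
        using S that m by auto
      also have "\<dots> = (\<Sum>k\<in>{m}. F i k * H k * E k m)"
        using m FE(2)[of m] by (intro sum.mono_neutral_right) auto
      finally show ?thesis using FE(1)[OF m] by simp
    qed
    have 2: "schur T m m j = H m * E m j" if "j \<in> {m..n}" for j
    proof -
      have "schur T m m j = (\<Sum>k=m..n. F m k * H k * E k j)"
        using S that m by auto
      also have "\<dots> = (\<Sum>k\<in>{m}. F m k * H k * E k j)"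
        using m FE(2)[of m] by (intro sum.mono_neutral_right) auto
      finally show ?thesis using FE(1)[OF m] by simp
    qed
    from 1 2 1[of m] FE(1)[OF m] m show ?thesis by auto
  qed
  have "\<forall>i\<in>{m..n}. \<forall>j\<in>{m..n}. schur T m i j = (\<Sum>k=m..n. F i k * H k * E k j)"
    if "1 \<le> m" "m \<le> n" for m
    using that
  proof (induction m rule: dec_induct)
    case base
    then show ?case using G by (auto simp: gauss_decomposition_def)
  next
    case (step m)
    then have S: "\<forall>i\<in>{m..n}. \<forall>j\<in>{m..n}. schur T m i j = (\<Sum>k=m..n. F i k * H k * E k j)"
      and m: "m \<in> {1..n}" by auto
    note d = diag[OF S m]
    have inv: "fps_left_inverse (H m) 1 * H m = 1"
      using fps_unit_inverse(1) FE(1)[OF m] by blast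
    show ?case
    proof (intro ballI)
      fix i j assume ij: "i \<in> {Suc m..n}" "j \<in> {Suc m..n}"
      then have ij': "i \<in> {m..n}" "j \<in> {m..n}" by auto
      have "schur T m i m * fps_left_inverse (schur T m m m) 1 * schur T m m j
          = F i m * H m * fps_left_inverse (H m) 1 * (H m * E m j)"
        using d ij' by metis
      also have "\<dots> = F i m * H m * (fps_left_inverse (H m) 1 * H m) * E m j"
        by (simp only: mult.assoc)
      also have "\<dots> = F i m * H m * E m j"
        by (simp add: inv)
      finally have "schur T (Suc m) i j = schur T m i j - F i m * H m * E m j"
        using m by simp
      also have "schur T m i j = (\<Sum>k=m..n. F i k * H k * E k j)"
        using S ij' by blast
      also have "\<dots> = F i m * H m * E m j + (\<Sum>k=Suc m..n. F i k * H k * E k j)"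
        using m by (subst sum.atLeast_Suc_atMost) auto
      finally show "schur T (Suc m) i j = (\<Sum>k=Suc m..n. F i k * H k * E k j)"
        by simp
    qed
  qed
  from diag[OF this] assms(2) show ?thesis by auto
qed

definition yT :: "nat \<Rightarrow> nat \<Rightarrow> ('n :: finite) yangian fps" where
  "yT i j = Abs_fps (ygen i j)"

definition gauss_h :: "nat \<Rightarrow> ('n :: finite) yangian fps" where
  "gauss_h i = (THE h. \<exists>F H E. gauss_decomposition CARD('n) yT F H E \<and> h = H i)"

lemma gauss_h_unique:
  assumes "i \<in> {1..CARD('n :: finite)}"
  shows "\<exists>!h. \<exists>F H E. gauss_decomposition CARD('n) (yT :: _ \<Rightarrow> _ \<Rightarrow> 'n yangian fps) F H E \<and> h = H i"
proof -
  have T0: "fps_nth (yT i j :: 'n yangian fps) 0 = (if i = j then 1 else 0)" for i j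
    unfolding yT_def fps_nth_Abs_fps by transfer (simp add: ft_def yideal.zero)
  show ?thesis
  proof (rule ex1I, intro exI conjI)
    show "gauss_decomposition CARD('n) (yT :: _ \<Rightarrow> _ \<Rightarrow> 'n yangian fps)
      (\<lambda>i m. if i < m then 0 else if i = m then 1
              else schur yT m i m * fps_left_inverse (schur yT m m m) 1)
      (\<lambda>m. schur yT m m m)
      (\<lambda>m j. if j < m then 0 else if j = m then 1
              else fps_left_inverse (schur yT m m m) 1 * schur yT m m j)"
      using gauss_decomposition_exists[of "CARD('n)" "yT :: _ \<Rightarrow> _ \<Rightarrow> 'n yangian fps", OF T0]
      by simp
  qed (auto dest: gauss_decomposition_diag[OF _ assms])
qed

lemma gauss_h_eq:
  assumes "i \<in> {1..CARD('n :: finite)}"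
    and "gauss_decomposition CARD('n) (yT :: _ \<Rightarrow> _ \<Rightarrow> 'n yangian fps) F H E"
  shows "gauss_h i = H i"
  unfolding gauss_h_def using gauss_h_unique[OF assms(1)] assms(2) by (intro the1_equality) auto


section \<open>Drinfeld's Cartan loop generators\<close>

text \<open>\<open>g(u - c)\<close>, obtained by substituting \<open>(u - c)\<^sup>-\<^sup>1 = \<Sum>k\<ge>0. c\<^sup>k u\<^sup>-\<^sup>k\<^sup>-\<^sup>1\<close> for \<open>u\<^sup>-\<^sup>1\<close>.\<close>

definition u_shift :: "complex \<Rightarrow> ('n :: finite) yangian fps \<Rightarrow> 'n yangian fps" where
  "u_shift c g = g oo Abs_fps (\<lambda>m. if m = 0 then 0 else yconst (c ^ (m - 1)))"

text \<open>\<open>fps_left_inverse g 1\<close> is the two-sided inverse of a series with constant term \<open>1\<close>.\<close>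

definition drinfeld_series :: "nat \<Rightarrow> ('n :: finite) yangian fps" where
  "drinfeld_series i =
     fps_left_inverse (u_shift ((of_nat i - 1) / 2) (gauss_h i)) 1
     * u_shift ((of_nat i - 1) / 2) (gauss_h (i + 1))"

definition drinfeld_T :: "nat \<Rightarrow> nat \<Rightarrow> ('n :: finite) yangian" where
  "drinfeld_T i r = fps_nth (drinfeld_series i) (r + 1)"


section \<open>The maximal torus and its Lie algebra\<close>

text \<open>
  A diagonal matrix is given by its diagonal entries \<open>z 1, \<dots>, z n\<close>; outside \<open>{1..n}\<close> the function
  is \<open>1\<close> for elements of the torus and \<open>0\<close> for elements of its Lie algebra.  The tangent spaces
  of the torus are identified with its Lie algebra by translation.  Hence \<open>e\<^sup>\<theta>\<^sup>a z = z a\<close>, and the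
  translation-invariant one-form \<open>d\<theta>\<^sub>a\<close> evaluates to \<open>X a\<close> on the tangent vector \<open>X\<close>.
\<close>

definition SL_torus_reg :: "nat \<Rightarrow> (nat \<Rightarrow> complex) set" where
  "SL_torus_reg n = {z. (\<forall>k. k \<notin> {1..n} \<longrightarrow> z k = 1) \<and> (\<forall>k\<in>{1..n}. z k \<noteq> 0) \<and>
     (\<Prod>k=1..n. z k) = 1 \<and> inj_on z {1..n}}"

definition sl_cartan :: "nat \<Rightarrow> (nat \<Rightarrow> complex) set" where
  "sl_cartan n = {X. (\<forall>k. k \<notin> {1..n} \<longrightarrow> X k = 0) \<and> (\<Sum>k=1..n. X k) = 0}"

definition coroot :: "nat \<Rightarrow> nat \<Rightarrow> complex" where
  "coroot i = (\<lambda>k. if k = i then 1 else if k = i + 1 then - 1 else 0)"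

definition linear_form_on :: "(nat \<Rightarrow> complex) set \<Rightarrow> ((nat \<Rightarrow> complex) \<Rightarrow> complex) \<Rightarrow> bool" where
  "linear_form_on V l \<longleftrightarrow> (\<forall>X\<in>V. \<forall>Y\<in>V. l (\<lambda>k. X k + Y k) = l X + l Y) \<and>
     (\<forall>c. \<forall>X\<in>V. l (\<lambda>k. c * X k) = c * l X)"

definition fundamental_weights :: "nat \<Rightarrow> (nat \<Rightarrow> (nat \<Rightarrow> complex) \<Rightarrow> complex) \<Rightarrow> bool" where
  "fundamental_weights n \<omega> \<longleftrightarrow>
     (\<forall>i\<in>{1..<n}. linear_form_on (sl_cartan n) (\<omega> i)) \<and>
     (\<forall>i\<in>{1..<n}. \<forall>j\<in>{1..<n}. \<omega> i (coroot j) = (if i = j then 1 else 0))"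

lemma fundamental_weights_exist: "fundamental_weights n (\<lambda>i X. \<Sum>k=1..i. X k)"
proof -
  have "(\<Sum>k=1..i. coroot j k) = (if i = j then 1 else 0)" if "1 \<le> j" for i j
    using that by (induction i) (auto simp: coroot_def)
  then show ?thesis
    by (auto simp: fundamental_weights_def linear_form_on_def sum.distrib sum_distrib_left)
qed

definition cartan_embed :: "(nat \<Rightarrow> complex) \<Rightarrow> ('n :: finite) yangian" where
  "cartan_embed X = (\<Sum>k=1..CARD('n). X k *\<^sub>Y yE k k)"

text \<open>
  A one-form assigns to a point and a (translated) tangent vector a value.  The invariant vector
  fields \<open>X\<close> and \<open>Y\<close> commute, so \<open>d\<eta>(X, Y) = X(\<eta>(Y)) - Y(\<eta>(X))\<close>.
\<close>

definition closed_one_form ::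
  "nat \<Rightarrow> ((nat \<Rightarrow> complex) \<Rightarrow> (nat \<Rightarrow> complex) \<Rightarrow> (nat \<Rightarrow> complex)) \<Rightarrow> bool" where
  "closed_one_form n \<eta> \<longleftrightarrow>
     (\<forall>z\<in>SL_torus_reg n. \<forall>k. linear_form_on (sl_cartan n) (\<lambda>X. \<eta> z X k)) \<and>
     (\<forall>z\<in>SL_torus_reg n. \<forall>X\<in>sl_cartan n. \<forall>Y\<in>sl_cartan n. \<forall>k. \<exists>a b.
        ((\<lambda>s. \<eta> (\<lambda>m. exp (s * X m) * z m) Y k) has_field_derivative a) (at 0) \<and>
        ((\<lambda>s. \<eta> (\<lambda>m. exp (s * Y m) * z m) X k) has_field_derivative b) (at 0) \<and>
        a - b = 0)"


section \<open>The trigonometric Casimir connections\<close>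

text \<open>A connection \<open>\<nabla> = d + A\<close> on a trivial bundle is given by its one-form \<open>A\<close>.\<close>

definition casimir_D :: "nat \<Rightarrow> ('n :: finite) yangian" where
  "casimir_D i = 2 * ygen i i 2 - (\<Sum>j=1..<i. kappa j i) - yE i i ^ 2"

definition gl_casimir_form ::
  "(nat \<Rightarrow> complex) \<Rightarrow> (nat \<Rightarrow> complex) \<Rightarrow> ('n :: finite) yangian" where
  "gl_casimir_form z X =
     - (\<Sum>j=1..CARD('n). \<Sum>i=1..<j. ((X i - X j) / (z i / z j - 1)) *\<^sub>Y kappa i j)
     - (\<Sum>i=1..CARD('n). X i *\<^sub>Y casimir_D i)"

definition sl_casimir_form ::
  "(nat \<Rightarrow> (nat \<Rightarrow> complex) \<Rightarrow> complex) \<Rightarrow> (nat \<Rightarrow> complex) \<Rightarrow> (nat \<Rightarrow> complex) \<Rightarrow>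
   ('n :: finite) yangian" where
  "sl_casimir_form \<omega> z X =
     - (\<Sum>j=1..CARD('n). \<Sum>i=1..<j. ((X i - X j) / (z i / z j - 1)) *\<^sub>Y kappa i j)
     + 2 * (\<Sum>i=1..<CARD('n). \<omega> i X *\<^sub>Y (drinfeld_T i 1 - (1 / 2) *\<^sub>Y drinfeld_T i 0 ^ 2))"

definition cartan_correction ::
  "nat \<Rightarrow> (nat \<Rightarrow> (nat \<Rightarrow> complex) \<Rightarrow> complex) \<Rightarrow> (nat \<Rightarrow> complex) \<Rightarrow> (nat \<Rightarrow> complex) \<Rightarrow>
   (nat \<Rightarrow> complex)" where
  "cartan_correction n \<omega> z X = (\<lambda>k. - (\<Sum>i=1..<n. \<omega> i X * coroot i k))"

lemma cartan_embed_correction: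
  "cartan_embed (cartan_correction CARD('n) \<omega> z X)
   = - (\<Sum>i=1..<CARD('n). \<omega> i X *\<^sub>Y (yE i i - yE (i + 1) (i + 1) :: ('n :: finite) yangian))"
proof -
  interpret vector_space "(*\<^sub>Y) :: complex \<Rightarrow> 'n yangian \<Rightarrow> 'n yangian"
    by (rule yangian_complex_algebra)
  have cr: "(\<Sum>k=1..CARD('n). coroot i k *\<^sub>Y yE k k) = (yE i i - yE (i + 1) (i + 1) :: 'n yangian)"
    if "i \<in> {1..<CARD('n)}" for i
  proof -
    have "(\<Sum>k=1..CARD('n). coroot i k *\<^sub>Y yE k k)
        = (\<Sum>k\<in>{i, i + 1}. coroot i k *\<^sub>Y (yE k k :: 'n yangian))"
      using that by (intro sum.mono_neutral_right) (auto simp: coroot_def)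
    then show ?thesis by (simp add: coroot_def)
  qed
  have "cartan_embed (cartan_correction CARD('n) \<omega> z X)
      = - (\<Sum>k=1..CARD('n). \<Sum>i=1..<CARD('n). \<omega> i X *\<^sub>Y (coroot i k *\<^sub>Y (yE k k :: 'n yangian)))"
    by (simp add: cartan_embed_def cartan_correction_def scale_sum_left sum_negf scale_minus_left)
  also have "\<dots> = - (\<Sum>i=1..<CARD('n). \<omega> i X *\<^sub>Y (\<Sum>k=1..CARD('n). coroot i k *\<^sub>Y (yE k k :: 'n yangian)))"
    by (subst sum.swap) (simp add: scale_sum_right)
  finally show ?thesis using cr by simp
qed

end

theory Submission
  imports Defs
begin

text \<open>
  Only the coefficients of \<open>u\<^sup>-\<^sup>1\<close> and \<open>u\<^sup>-\<^sup>2\<close> of the series involved matter.  The off-diagonal entries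
  of \<open>T(u)\<close> have no constant term, so that Gaussian elimination changes the first
  coefficients of the remaining block not at all and the second ones by a quadratic expression in
  the \<open>E\<^sub>a\<^sub>b\<close>, which gives
  \<open>h\<^sub>i(u) = 1 + E\<^sub>i\<^sub>i u\<^sup>-\<^sup>1 + (t\<^sub>i\<^sub>i\<^sup>(\<^sup>2\<^sup>) - \<Sum>k<i. E\<^sub>i\<^sub>k E\<^sub>k\<^sub>i) u\<^sup>-\<^sup>2 + \<dots>\<close> (lemma \<open>gauss_h_nth\<close>).
  Shifting, inverting and multiplying such expansions expresses \<open>T\<^sub>i\<^sub>,\<^sub>0\<close> and \<open>T\<^sub>i\<^sub>,\<^sub>1\<close> in the generators,
  and with \<open>[E\<^sub>i\<^sub>k, E\<^sub>k\<^sub>i] = E\<^sub>i\<^sub>i - E\<^sub>k\<^sub>k\<close> one finds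
  \<open>2 (T\<^sub>i\<^sub>,\<^sub>1 - T\<^sub>i\<^sub>,\<^sub>0\<^sup>2 / 2) = - (D\<^sub>i - D\<^sub>i\<^sub>+\<^sub>1) + (E\<^sub>i\<^sub>i - E\<^sub>i\<^sub>+\<^sub>1\<^sub>,\<^sub>i\<^sub>+\<^sub>1)\<close> (lemma \<open>drinfeld_T_casimir_D\<close>).

  On traceless \<open>X\<close> one has \<open>X = \<Sum>i. \<lambda>\<^sub>i(X) \<alpha>\<^sub>i\<^sup>\<or>\<close> (lemma \<open>fundamental_weights_expansion\<close>), hence
  \<open>\<Sum>i. X\<^sub>i D\<^sub>i = \<Sum>i. \<lambda>\<^sub>i(X) (D\<^sub>i - D\<^sub>i\<^sub>+\<^sub>1)\<close> by summation by parts; this is the comparison of the two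
  connections.  The same expansion shows that the correction is the one-form \<open>X \<mapsto> - X\<close>, which
  is traceless and translation invariant, hence closed.

  Finally, an automorphism \<open>T(u) \<mapsto> f(u) T(u)\<close> fixes the \<open>E\<^sub>a\<^sub>b\<close> with \<open>a \<noteq> b\<close> and moves every \<open>D\<^sub>i\<close> by the
  same scalar \<open>2 f\<^sub>2 - f\<^sub>1\<^sup>2\<close> (lemma \<open>casimir_D_automorphism\<close>), which cancels in \<open>\<Sum>i. X\<^sub>i D\<^sub>i\<close> as \<open>X\<close> has
  trace zero.
\<close>

section \<open>Second-order expansions of noncommutative power series\<close>

lemma fps_mult_nth_Suc_0:
  "fps_nth (f * g) (Suc 0) = fps_nth f 0 * fps_nth g (Suc 0) + fps_nth f (Suc 0) * fps_nth g 0"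
  by (simp add: fps_mult_nth)

lemma fps_mult_nth_2:
  "fps_nth (f * g) 2 =
     fps_nth f 0 * fps_nth g 2 + fps_nth f (Suc 0) * fps_nth g (Suc 0) + fps_nth f 2 * fps_nth g 0"
  by (simp add: fps_mult_nth numeral_2_eq_2 add.assoc)

lemma fps_left_inverse_expansion:
  fixes g :: "'a :: ring_1 fps"
  assumes "fps_nth g 0 = 1"
  shows "fps_nth (fps_left_inverse g 1) 0 = 1"
    and "fps_nth (fps_left_inverse g 1) (Suc 0) = - fps_nth g (Suc 0)"
    and "fps_nth (fps_left_inverse g 1) 2 = fps_nth g (Suc 0) ^ 2 - fps_nth g 2"
proof -
  let ?L = "fps_left_inverse g 1"
  have L: "?L * g = 1"
    by (rule fps_unit_inverse(1)[OF assms])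
  show L0: "fps_nth ?L 0 = 1"
    by simp
  have "fps_nth (?L * g) (Suc 0) = 0"
    by (simp add: L)
  then show L1: "fps_nth ?L (Suc 0) = - fps_nth g (Suc 0)"
    unfolding fps_mult_nth_Suc_0 by (simp add: assms eq_neg_iff_add_eq_0 add.commute)
  have "fps_nth (?L * g) 2 = 0"
    by (simp add: L)
  then show "fps_nth ?L 2 = fps_nth g (Suc 0) ^ 2 - fps_nth g 2"
    unfolding fps_mult_nth_2 L0 L1 assms
    by (simp add: power2_eq_square algebra_simps add_eq_0_iff)
qed

text \<open>The correction term of one elimination step is a product of two series without constant term.\<close>

lemma schur_expansion:
  assumes T0: "\<And>i j. \<lbrakk>i \<in> {1..n}; j \<in> {1..n}\<rbrakk> \<Longrightarrow> fps_nth (T i j) 0 = (if i = j then 1 else 0)"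
    and "1 \<le> m" "m \<le> i" "m \<le> j" "i \<le> n" "j \<le> n"
  shows "fps_nth (schur T m i j) (Suc 0) = fps_nth (T i j) (Suc 0) \<and>
    fps_nth (schur T m i j) 2
      = fps_nth (T i j) 2 - (\<Sum>k=1..<m. fps_nth (T i k) (Suc 0) * fps_nth (T k j) (Suc 0))"
  using assms(2-)
proof (induction m arbitrary: i j)
  case (Suc m)
  show ?case
  proof (cases "m = 0")
    case False
    with Suc.prems have m: "1 \<le> m" "m \<le> i" "m \<le> j" "m \<le> n" "i \<noteq> m" "m \<noteq> j"
      by auto
    have z: "fps_nth (schur T m i m) 0 = 0" "fps_nth (schur T m m j) 0 = 0"
      using schur_nth_0[of n T m i m, OF T0] schur_nth_0[of n T m m j, OF T0] m Suc.prems by auto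
    have IH: "fps_nth (schur T m i m) (Suc 0) = fps_nth (T i m) (Suc 0)"
        "fps_nth (schur T m m j) (Suc 0) = fps_nth (T m j) (Suc 0)"
      using Suc.IH[of i m] Suc.IH[of m j] m Suc.prems by auto
    show ?thesis
      using Suc.IH[of i j] m Suc.prems False
      by (simp add: fps_mult_nth_Suc_0 fps_mult_nth_2 z IH diff_diff_eq atLeastLessThanSuc
          add.commute)
  qed simp
qed simp


section \<open>Relations in the Yangian\<close>

lemma ygen_0: "ygen i j 0 = (if i = j then 1 else 0)"
  by transfer (simp add: ft_def yideal.zero)

lemma yconst_of_nat: "yconst (of_nat m) = of_nat m"
  by (induction m) (simp_all add: yconst_simps)

lemma yconst_numeral: "yconst (numeral k) = numeral k"
  using yconst_of_nat[of "numeral k"] by simp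

lemma yE_commutator:
  assumes "i \<in> {1..CARD('n)}" "j \<in> {1..CARD('n)}" "k \<in> {1..CARD('n)}" "l \<in> {1..CARD('n)}"
  shows "yE i j * yE k l - yE k l * yE i j
    = (if k = j then yE i l else 0) - (if i = l then yE k j else (0 :: ('n :: finite) yangian))"
  using ygen_relation[OF assms, of 0 1] by (cases "i = j") (simp_all add: yE_def ygen_0)

lemma yE_diag_commute:
  assumes "i \<in> {1..CARD('n)}" "j \<in> {1..CARD('n)}"
  shows "yE i i * yE j j = yE j j * (yE i i :: ('n :: finite) yangian)"
  using yE_commutator[of i i j j, where 'n = 'n] assms by (auto split: if_splits)

lemma gauss_h_nth:
  assumes "i \<in> {1..CARD('n)}"
  shows "fps_nth (gauss_h i :: ('n :: finite) yangian fps) 0 = 1"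
    and "fps_nth (gauss_h i :: 'n yangian fps) (Suc 0) = yE i i"
    and "fps_nth (gauss_h i :: 'n yangian fps) 2
      = ygen i i 2 - (\<Sum>k=1..<i. yE i k * yE k i)"
proof -
  have T0: "fps_nth (yT i j :: 'n yangian fps) 0 = (if i = j then 1 else 0)" for i j
    by (simp add: yT_def ygen_0)
  have h: "gauss_h i = schur (yT :: _ \<Rightarrow> _ \<Rightarrow> 'n yangian fps) i i i"
    using gauss_h_eq[OF assms gauss_decomposition_exists[of "CARD('n)" yT, OF T0]] .
  show "fps_nth (gauss_h i :: 'n yangian fps) 0 = 1"
    unfolding h using schur_nth_0[of "CARD('n)" yT i i i, OF T0] assms by auto
  show "fps_nth (gauss_h i :: 'n yangian fps) (Suc 0) = yE i i"
    "fps_nth (gauss_h i :: 'n yangian fps) 2 = ygen i i 2 - (\<Sum>k=1..<i. yE i k * yE k i)"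
    unfolding h using schur_expansion[of "CARD('n)" yT i i i, OF T0] assms
    by (simp_all add: yT_def yE_def)
qed

text \<open>To second order, the substitution is \<open>u\<^sup>-\<^sup>1 \<mapsto> u\<^sup>-\<^sup>1 + c u\<^sup>-\<^sup>2\<close>.\<close>

lemma u_shift_expansion:
  "fps_nth (u_shift c g) 0 = fps_nth g 0"
  "fps_nth (u_shift c g) (Suc 0) = fps_nth g (Suc 0)"
  "fps_nth (u_shift c g) 2 = fps_nth g 2 + c *\<^sub>Y fps_nth g (Suc 0)"
proof -
  let ?s = "Abs_fps (\<lambda>m. if m = 0 then 0 else yconst (c ^ (m - 1)))"
  have s: "fps_nth ?s 0 = 0" "fps_nth ?s (Suc 0) = 1" "fps_nth ?s 2 = yconst c"
    by (simp_all add: yconst_simps)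
  have ss: "fps_nth (?s ^ 2) 0 = 0" "fps_nth (?s ^ 2) (Suc 0) = 0" "fps_nth (?s ^ 2) 2 = 1"
    unfolding power2_eq_square fps_mult_nth_Suc_0 fps_mult_nth_2 fps_mult_nth_0 s by simp_all
  show "fps_nth (u_shift c g) 0 = fps_nth g 0"
    by (simp add: u_shift_def fps_compose_nth)
  show "fps_nth (u_shift c g) (Suc 0) = fps_nth g (Suc 0)"
    by (simp add: u_shift_def fps_compose_nth yconst_simps)
  have "{0..2 :: nat} = {0, Suc 0, 2}"
    by auto
  then have "fps_nth (u_shift c g) 2
      = fps_nth g 0 * fps_nth (?s ^ 0) 2 + (fps_nth g (Suc 0) * fps_nth (?s ^ Suc 0) 2
        + fps_nth g 2 * fps_nth (?s ^ 2) 2)"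
    unfolding u_shift_def fps_compose_nth by simp
  then show "fps_nth (u_shift c g) 2 = fps_nth g 2 + c *\<^sub>Y fps_nth g (Suc 0)"
    unfolding ss power_Suc power_0 mult_1_right s
    by (simp add: yscale_def yconst_central[of c] add.commute)
qed

section \<open>Drinfeld's generators and the elements \<open>D\<^sub>i\<close>\<close>

text \<open>Reordering \<open>E\<^sub>k\<^sub>i E\<^sub>i\<^sub>k\<close> in \<open>\<kappa>\<close> produces the linear terms.\<close>

lemma casimir_D_gauss_h:
  assumes "i \<in> {1..CARD('n)}"
  shows "(casimir_D i :: ('n :: finite) yangian)
    = 2 * fps_nth (gauss_h i) 2 + of_nat (i - 1) * yE i i - (\<Sum>k=1..<i. yE k k) - yE i i ^ 2"
proof -
  have "kappa k i = 2 * (yE i k * yE k i) - yE i i + (yE k k :: 'n yangian)"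
    if "k \<in> {1..<i}" for k
    using yE_commutator[of i k k i, where 'n = 'n] that assms
    by (simp add: kappa_def mult_2 algebra_simps)
  then have "(\<Sum>k=1..<i. kappa k i :: 'n yangian)
      = (\<Sum>k=1..<i. 2 * (yE i k * yE k i) - yE i i + yE k k)"
    by (intro sum.cong) auto
  also have "\<dots> = 2 * (\<Sum>k=1..<i. yE i k * yE k i) - of_nat (i - 1) * yE i i + (\<Sum>k=1..<i. yE k k)"
    by (simp add: sum.distrib sum_subtractf sum_distrib_left)
  finally show ?thesis
    unfolding casimir_D_def gauss_h_nth(3)[OF assms] by (simp add: algebra_simps)
qed

lemma drinfeld_T_expansion:
  assumes "i \<in> {1..<CARD('n)}"
  shows "(drinfeld_T i 0 :: ('n :: finite) yangian) = yE (i + 1) (i + 1) - yE i i"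
    and "(drinfeld_T i 1 :: 'n yangian)
      = fps_nth (gauss_h (i + 1)) 2 - fps_nth (gauss_h i) 2 + yE i i ^ 2 - yE i i * yE (i + 1) (i + 1)
        + ((of_nat i - 1) / 2) *\<^sub>Y (yE (i + 1) (i + 1) - yE i i)"
proof -
  let ?c = "(of_nat i - 1) / 2 :: complex"
  have i: "i \<in> {1..CARD('n)}" "i + 1 \<in> {1..CARD('n)}"
    using assms by auto
  note h = gauss_h_nth[OF i(1)] gauss_h_nth(1,2)[OF i(2)]
  have g: "fps_nth (u_shift ?c (gauss_h i) :: 'n yangian fps) 0 = 1"
    unfolding u_shift_expansion h ..
  show "(drinfeld_T i 0 :: 'n yangian) = yE (i + 1) (i + 1) - yE i i"
    unfolding drinfeld_T_def drinfeld_series_def add_0 One_nat_def[symmetric]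
    unfolding One_nat_def fps_mult_nth_Suc_0 fps_left_inverse_expansion[OF g] u_shift_expansion
    using gauss_h_nth(1,2)[OF i(1)] gauss_h_nth(1,2)[OF i(2)] by simp
  show "(drinfeld_T i 1 :: 'n yangian)
      = fps_nth (gauss_h (i + 1)) 2 - fps_nth (gauss_h i) 2 + yE i i ^ 2 - yE i i * yE (i + 1) (i + 1)
        + ?c *\<^sub>Y (yE (i + 1) (i + 1) - yE i i)"
    unfolding drinfeld_T_def drinfeld_series_def one_add_one
    unfolding fps_mult_nth_2 fps_left_inverse_expansion[OF g] u_shift_expansion
      gauss_h_nth(1,2)[OF i(1)] gauss_h_nth(1,2)[OF i(2)]
    by (simp add: yscale_def algebra_simps)
qed

lemma drinfeld_T_casimir_D:
  assumes "i \<in> {1..<CARD('n)}"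
  shows "2 * (drinfeld_T i 1 - (1 / 2) *\<^sub>Y drinfeld_T i 0 ^ 2 :: ('n :: finite) yangian)
    = - (casimir_D i - casimir_D (i + 1)) + (yE i i - yE (i + 1) (i + 1))"
proof -
  define a b where "a = (yE i i :: 'n yangian)" and "b = (yE (i + 1) (i + 1) :: 'n yangian)"
  have i: "i \<in> {1..CARD('n)}" "i + 1 \<in> {1..CARD('n)}"
    using assms by auto
  have ab: "b * a = a * b"
    unfolding a_def b_def by (rule yE_diag_commute[OF i(2,1)])
  have half: "2 * (c *\<^sub>Y x) = (2 * c) *\<^sub>Y x" for c and x :: "'n yangian"
    by (simp add: yscale_def yconst_simps yconst_numeral mult.assoc)
  obtain m where m: "i = Suc m"
    using assms by (cases i) auto
  have nat: "(2 * ((of_nat i - 1) / 2)) *\<^sub>Y x = of_nat m * x" for x :: "'n yangian"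
    by (simp add: yscale_def yconst_of_nat m)
  have "2 * (drinfeld_T i 1 - (1 / 2) *\<^sub>Y drinfeld_T i 0 ^ 2 :: 'n yangian)
      = 2 * fps_nth (gauss_h (i + 1)) 2 - 2 * fps_nth (gauss_h i) 2 + 2 * a ^ 2 - 2 * (a * b)
        + of_nat m * (b - a) - (b - a) ^ 2"
    unfolding drinfeld_T_expansion[OF assms] a_def[symmetric] b_def[symmetric]
    by (simp only: right_diff_distrib distrib_left half nat) (simp add: yscale_def yconst_simps)
  also have "(b - a) ^ 2 = b ^ 2 + a ^ 2 - 2 * (a * b)"
    by (simp add: power2_eq_square mult_2 algebra_simps ab)
  finally have T: "2 * (drinfeld_T i 1 - (1 / 2) *\<^sub>Y drinfeld_T i 0 ^ 2)
      = 2 * fps_nth (gauss_h (i + 1)) 2 - 2 * fps_nth (gauss_h i) 2 + 2 * a ^ 2 - 2 * (a * b)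
        + of_nat m * (b - a) - (b ^ 2 + a ^ 2 - 2 * (a * b))" .
  have S: "(\<Sum>k=1..<i + 1. yE k k) = (\<Sum>k=1..<i. yE k k) + a"
    using assms by (simp add: a_def)
  have "i - 1 = m" "i + 1 - 1 = Suc m"
    using m by auto
  then show ?thesis
    unfolding T casimir_D_gauss_h[OF i(1)] casimir_D_gauss_h[OF i(2)] S
      a_def[symmetric] b_def[symmetric]
    by (simp add: mult_2 algebra_simps del: add_Suc_right)
qed


section \<open>Invariance under \<open>T(u) \<mapsto> f(u) T(u)\<close>\<close>

context
  fixes f :: "complex fps" and \<phi> :: "('n :: finite) yangian \<Rightarrow> 'n yangian"
  assumes f0: "fps_nth f 0 = 1" and aut: "yalg_automorphism \<phi>" and mult: "multiplies_T_by f \<phi>"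
begin

lemma automorphism_simps:
  "\<phi> 1 = 1" "\<phi> (x + y) = \<phi> x + \<phi> y" "\<phi> (x * y) = \<phi> x * \<phi> y" "\<phi> (c *\<^sub>Y x) = c *\<^sub>Y \<phi> x"
  using aut by (auto simp: yalg_automorphism_def)

lemma automorphism_0: "\<phi> 0 = 0"
  using automorphism_simps(2)[of 0 0] by simp

lemma automorphism_diff: "\<phi> (x - y) = \<phi> x - \<phi> y"
  using automorphism_simps(2)[of "x - y" y] by (simp add: algebra_simps)

lemma automorphism_minus: "\<phi> (- x) = - \<phi> x"
  using automorphism_diff[of 0 x] by (simp add: automorphism_0)

lemma automorphism_sum: "\<phi> (sum g A) = (\<Sum>x\<in>A. \<phi> (g x))"
  by (induction A rule: infinite_finite_induct) (simp_all add: automorphism_0 automorphism_simps)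

lemma yE_automorphism:
  assumes "i \<in> {1..CARD('n)}" "j \<in> {1..CARD('n)}"
  shows "\<phi> (yE i j) = yE i j + (if i = j then yconst (fps_nth f 1) else 0)"
  using mult assms f0
  by (simp add: multiplies_T_by_def yE_def ygen_0 yscale_def yconst_simps)

lemma ygen_2_automorphism:
  assumes "i \<in> {1..CARD('n)}"
  shows "\<phi> (ygen i i 2) = ygen i i 2 + yconst (fps_nth f 1) * yE i i + yconst (fps_nth f 2)"
  using mult assms f0
  by (simp add: multiplies_T_by_def yE_def ygen_0 yscale_def yconst_simps numeral_2_eq_2)

lemma kappa_automorphism:
  assumes "i \<in> {1..CARD('n)}" "j \<in> {1..CARD('n)}" "i \<noteq> j"
  shows "\<phi> (kappa i j) = kappa i j"
  using assms by (simp add: kappa_def automorphism_simps yE_automorphism)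

lemma casimir_D_automorphism:
  assumes "i \<in> {1..CARD('n)}"
  shows "\<phi> (casimir_D i) = casimir_D i + yconst (2 * fps_nth f 2 - fps_nth f 1 ^ 2)"
proof -
  have k: "(\<Sum>j=1..<i. \<phi> (kappa j i)) = (\<Sum>j=1..<i. kappa j i)"
    using assms by (intro sum.cong) (auto intro!: kappa_automorphism)
  have c: "yE i i * yconst (fps_nth f 1) = yconst (fps_nth f 1) * yE i i"
    by (simp add: yconst_central)
  have "yconst (2 * fps_nth f 2 - fps_nth f 1 ^ 2) + yconst (fps_nth f 1) * yconst (fps_nth f 1)
      = (2 * yconst (fps_nth f 2) :: 'n yangian)"
    unfolding yconst_simps(3,4)[symmetric] yconst_numeral[symmetric]
    by (simp add: power2_eq_square)
  then have d: "yconst (2 * fps_nth f 2 - fps_nth f 1 ^ 2)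
      = 2 * yconst (fps_nth f 2) - yconst (fps_nth f 1) * (yconst (fps_nth f 1) :: 'n yangian)"
    by (simp add: eq_diff_eq)
  have "\<phi> (casimir_D i) = 2 * (ygen i i 2 + yconst (fps_nth f 1) * yE i i + yconst (fps_nth f 2))
      - (\<Sum>j=1..<i. kappa j i) - (yE i i + yconst (fps_nth f 1)) ^ 2"
    by (simp add: casimir_D_def automorphism_diff automorphism_sum k mult_2 power2_eq_square
        automorphism_simps(2,3) ygen_2_automorphism[OF assms] yE_automorphism[OF assms assms]
        del: One_nat_def)
  also have "(yE i i + yconst (fps_nth f 1)) ^ 2 = yE i i ^ 2
      + 2 * (yconst (fps_nth f 1) * yE i i) + yconst (fps_nth f 1) * yconst (fps_nth f 1)"
    unfolding power2_eq_square distrib_left distrib_right c mult_2 by (simp add: add.assoc)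
  finally show ?thesis
    unfolding casimir_D_def d by (simp add: distrib_left)
qed

lemma gl_casimir_form_automorphism:
  assumes X: "X \<in> sl_cartan CARD('n)"
  shows "\<phi> (gl_casimir_form z X) = gl_casimir_form z X"
proof -
  let ?d = "2 * fps_nth f 2 - fps_nth f 1 ^ 2"
  interpret vector_space "(*\<^sub>Y) :: complex \<Rightarrow> 'n yangian \<Rightarrow> 'n yangian"
    by (rule yangian_complex_algebra)
  have k: "(\<Sum>j=1..CARD('n). \<Sum>i=1..<j. a i j *\<^sub>Y \<phi> (kappa i j))
      = (\<Sum>j=1..CARD('n). \<Sum>i=1..<j. a i j *\<^sub>Y kappa i j)" for a
    by (intro sum.cong refl arg_cong2[where f = yscale] kappa_automorphism) auto
  have "(\<Sum>i=1..CARD('n). X i *\<^sub>Y \<phi> (casimir_D i))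
      = (\<Sum>i=1..CARD('n). X i *\<^sub>Y casimir_D i + X i *\<^sub>Y yconst ?d)"
    by (intro sum.cong refl) (simp add: casimir_D_automorphism scale_right_distrib)
  also have "\<dots> = (\<Sum>i=1..CARD('n). X i *\<^sub>Y casimir_D i) + (\<Sum>i=1..CARD('n). X i) *\<^sub>Y yconst ?d"
    by (simp add: sum.distrib scale_sum_left)
  also have "(\<Sum>i=1..CARD('n). X i) = 0"
    using X by (simp add: sl_cartan_def)
  finally show ?thesis
    unfolding gl_casimir_form_def automorphism_diff automorphism_minus automorphism_sum
      automorphism_simps k
    by simp
qed

end


section \<open>Fundamental weights as coordinates\<close>

lemma coroot_in_sl_cartan:
  assumes "i \<in> {1..<n}"
  shows "coroot i \<in> sl_cartan n"
proof -
  have "(\<Sum>k=1..n. coroot i k) = (\<Sum>k\<in>{i, i + 1}. coroot i k)"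
    using assms by (intro sum.mono_neutral_right) (auto simp: coroot_def)
  then show ?thesis
    using assms by (auto simp: sl_cartan_def coroot_def)
qed

lemma sl_cartan_add: "X \<in> sl_cartan n \<Longrightarrow> Y \<in> sl_cartan n \<Longrightarrow> (\<lambda>k. X k + Y k) \<in> sl_cartan n"
  by (simp add: sl_cartan_def sum.distrib)

lemma sl_cartan_scale: "X \<in> sl_cartan n \<Longrightarrow> (\<lambda>k. c * X k) \<in> sl_cartan n"
  by (simp add: sl_cartan_def sum_distrib_left[symmetric])

lemma linear_form_on_sum_coroot:
  assumes l: "linear_form_on (sl_cartan n) l" and "finite A" "A \<subseteq> {1..<n}"
  shows "(\<lambda>k. \<Sum>i\<in>A. c i * coroot i k) \<in> sl_cartan n \<and>
    l (\<lambda>k. \<Sum>i\<in>A. c i * coroot i k) = (\<Sum>i\<in>A. c i * l (coroot i))"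
  using assms(2,3)
proof (induction A rule: finite_induct)
  case empty
  have 0: "(\<lambda>k. 0) \<in> sl_cartan n"
    by (simp add: sl_cartan_def)
  have "\<forall>c. \<forall>X\<in>sl_cartan n. l (\<lambda>k. c * X k) = c * l X"
    using l by (simp add: linear_form_on_def)
  from this[rule_format, OF 0, of 0] 0 show ?case
    by simp
next
  case (insert i A)
  then have i: "coroot i \<in> sl_cartan n"
    by (intro coroot_in_sl_cartan) auto
  with insert l show ?case
    by (simp add: sl_cartan_add sl_cartan_scale linear_form_on_def)
qed

text \<open>The sum telescopes; at \<open>k = n\<close> it is the vanishing trace that gives \<open>X n\<close>.\<close>

lemma sl_cartan_eq_sum_coroot:
  assumes X: "X \<in> sl_cartan n"
  shows "X = (\<lambda>k. \<Sum>i=1..<n. (\<Sum>j=1..i. X j) * coroot i k)"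
proof
  fix k
  let ?S = "\<lambda>i. \<Sum>j=1..i. X j"
  have "(\<Sum>i=1..<n. ?S i * coroot i k)
      = (\<Sum>i=1..<n. (if i = k then ?S i else 0) - (if i = k - 1 then ?S i else 0))"
    by (intro sum.cong) (auto simp: coroot_def)
  also have "\<dots> = (if k \<in> {1..<n} then ?S k else 0) - (if k - 1 \<in> {1..<n} then ?S (k - 1) else 0)"
    by (simp add: sum_subtractf)
  also have "\<dots> = X k"
  proof (cases "k \<in> {1..n}")
    case True
    then obtain k' where k': "k = Suc k'"
      by (cases k) auto
    have "?S n = 0"
      using X by (simp add: sl_cartan_def)
    then show ?thesis
      using True by (cases "k = n") (auto simp: k' add_eq_0_iff Suc_le_eq intro!: gr0I)
  next
    case False
    then show ?thesis
      using X by (auto simp: sl_cartan_def)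
  qed
  finally show "X k = (\<Sum>i=1..<n. ?S i * coroot i k)" ..
qed

lemma fundamental_weights_expansion:
  assumes \<omega>: "fundamental_weights n \<omega>" and X: "X \<in> sl_cartan n"
  shows "(\<Sum>i=1..<n. \<omega> i X * coroot i k) = X k"
proof -
  have "\<omega> i X = (\<Sum>j=1..i. X j)" if i: "i \<in> {1..<n}" for i
  proof -
    have "\<omega> i X = \<omega> i (\<lambda>k. \<Sum>i=1..<n. (\<Sum>j=1..i. X j) * coroot i k)"
      using sl_cartan_eq_sum_coroot[OF X] by simp
    also have "\<dots> = (\<Sum>m=1..<n. (\<Sum>j=1..m. X j) * \<omega> i (coroot m))"
      using linear_form_on_sum_coroot[of n "\<omega> i" "{1..<n}"] \<omega> i
      by (simp add: fundamental_weights_def)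
    also have "\<dots> = (\<Sum>m=1..<n. if m = i then \<Sum>j=1..m. X j else 0)"
      using \<omega> i by (intro sum.cong) (auto simp: fundamental_weights_def)
    finally show ?thesis
      using i by simp
  qed
  then have "(\<Sum>i=1..<n. \<omega> i X * coroot i k) = (\<Sum>i=1..<n. (\<Sum>j=1..i. X j) * coroot i k)"
    by (intro sum.cong) auto
  then show ?thesis
    using fun_cong[OF sl_cartan_eq_sum_coroot[OF X], of k] by simp
qed

lemma cartan_correction_eq:
  assumes "fundamental_weights n \<omega>" "X \<in> sl_cartan n"
  shows "cartan_correction n \<omega> z X = (\<lambda>k. - X k)"
  using fundamental_weights_expansion[OF assms] by (simp add: cartan_correction_def)

lemma cartan_correction_closed:
  assumes "fundamental_weights n \<omega>"
  shows "closed_one_form n (cartan_correction n \<omega>)"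
proof -
  have lin: "linear_form_on (sl_cartan n) (\<lambda>X. cartan_correction n \<omega> z X k)" for z k
    by (simp add: linear_form_on_def cartan_correction_eq[OF assms] sl_cartan_add sl_cartan_scale)
  have deriv: "((\<lambda>s. cartan_correction n \<omega> (w s) Y k) has_field_derivative 0) (at 0)"
    for w :: "complex \<Rightarrow> nat \<Rightarrow> complex" and Y k
    unfolding cartan_correction_def by (rule DERIV_const)
  show ?thesis
    unfolding closed_one_form_def
    by (intro conjI ballI allI exI[of _ 0] lin deriv) simp
qed

text \<open>Summation by parts.\<close>

lemma sum_casimir_D_fundamental_weights:
  assumes \<omega>: "fundamental_weights CARD('n) \<omega>" and X: "X \<in> sl_cartan CARD('n)"
  shows "(\<Sum>k=1..CARD('n). X k *\<^sub>Y d k)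
    = (\<Sum>i=1..<CARD('n). \<omega> i X *\<^sub>Y (d i - d (i + 1) :: ('n :: finite) yangian))"
proof -
  interpret vector_space "(*\<^sub>Y) :: complex \<Rightarrow> 'n yangian \<Rightarrow> 'n yangian"
    by (rule yangian_complex_algebra)
  have cr: "(\<Sum>k=1..CARD('n). coroot i k *\<^sub>Y d k) = d i - d (i + 1)" if "i \<in> {1..<CARD('n)}" for i
  proof -
    have "(\<Sum>k=1..CARD('n). coroot i k *\<^sub>Y d k) = (\<Sum>k\<in>{i, i + 1}. coroot i k *\<^sub>Y d k)"
      using that by (intro sum.mono_neutral_right) (auto simp: coroot_def)
    then show ?thesis
      by (simp add: coroot_def)
  qed
  have "(\<Sum>k=1..CARD('n). X k *\<^sub>Y d k)
      = (\<Sum>k=1..CARD('n). \<Sum>i=1..<CARD('n). \<omega> i X *\<^sub>Y (coroot i k *\<^sub>Y d k))"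
    using fundamental_weights_expansion[OF \<omega> X] by (simp add: scale_sum_left[symmetric])
  also have "\<dots> = (\<Sum>i=1..<CARD('n). \<omega> i X *\<^sub>Y (\<Sum>k=1..CARD('n). coroot i k *\<^sub>Y d k))"
    by (subst sum.swap) (simp add: scale_sum_right)
  finally show ?thesis
    using cr by simp
qed


section \<open>Comparison of the two connections\<close>

lemma gl_casimir_form_eq_sl:
  assumes \<omega>: "fundamental_weights CARD('n) \<omega>" and X: "X \<in> sl_cartan CARD('n)"
  shows "(gl_casimir_form z X :: ('n :: finite) yangian)
    = sl_casimir_form \<omega> z X + cartan_embed (cartan_correction CARD('n) \<omega> z X)"
proof -
  interpret vector_space "(*\<^sub>Y) :: complex \<Rightarrow> 'n yangian \<Rightarrow> 'n yangian"
    by (rule yangian_complex_algebra)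
  have "2 * (\<Sum>i=1..<CARD('n). \<omega> i X *\<^sub>Y (drinfeld_T i 1 - (1 / 2) *\<^sub>Y drinfeld_T i 0 ^ 2 :: 'n yangian))
      = (\<Sum>i=1..<CARD('n). \<omega> i X *\<^sub>Y (2 * (drinfeld_T i 1 - (1 / 2) *\<^sub>Y drinfeld_T i 0 ^ 2)))"
    by (simp add: sum_distrib_left yangian_complex_algebra(3))
  also have "\<dots> = (\<Sum>i=1..<CARD('n). \<omega> i X *\<^sub>Y
      (- (casimir_D i - casimir_D (i + 1)) + (yE i i - yE (i + 1) (i + 1))))"
    by (intro sum.cong refl arg_cong2[where f = yscale] drinfeld_T_casimir_D)
  also have "\<dots> = - (\<Sum>i=1..<CARD('n). \<omega> i X *\<^sub>Y (casimir_D i - casimir_D (i + 1)))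
      + (\<Sum>i=1..<CARD('n). \<omega> i X *\<^sub>Y (yE i i - yE (i + 1) (i + 1)))"
    by (simp only: scale_right_distrib scale_minus_right sum.distrib sum_negf)
  finally show ?thesis
    unfolding gl_casimir_form_def sl_casimir_form_def cartan_embed_correction
      sum_casimir_D_fundamental_weights[OF \<omega> X]
    by simp
qed

theorem mainTheorem12:
  fixes \<omega> :: "nat \<Rightarrow> (nat \<Rightarrow> complex) \<Rightarrow> complex"
  assumes "CARD('n :: finite) \<ge> 2"
    and "fundamental_weights CARD('n) \<omega>"
  shows "(\<forall>z\<in>SL_torus_reg CARD('n). \<forall>X\<in>sl_cartan CARD('n).
            (gl_casimir_form z X :: 'n yangian) \<in> yangian_sl)
       \<and> (\<forall>z\<in>SL_torus_reg CARD('n). \<forall>X\<in>sl_cartan CARD('n).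
            (gl_casimir_form z X :: 'n yangian)
            = sl_casimir_form \<omega> z X + cartan_embed (cartan_correction CARD('n) \<omega> z X))
       \<and> (\<forall>z\<in>SL_torus_reg CARD('n). \<forall>X\<in>sl_cartan CARD('n).
            cartan_correction CARD('n) \<omega> z X \<in> sl_cartan CARD('n))
       \<and> closed_one_form CARD('n) (cartan_correction CARD('n) \<omega>)"
proof (intro conjI ballI)
  fix z X assume X: "X \<in> sl_cartan CARD('n)"
  show "(gl_casimir_form z X :: 'n yangian) \<in> yangian_sl"
    unfolding yangian_sl_def using gl_casimir_form_automorphism[OF _ _ _ X] by blast
  show "(gl_casimir_form z X :: 'n yangian)
      = sl_casimir_form \<omega> z X + cartan_embed (cartan_correction CARD('n) \<omega> z X)"
    by (rule gl_casimir_form_eq_sl[OF assms(2) X])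
  show "cartan_correction CARD('n) \<omega> z X \<in> sl_cartan CARD('n)"
    using sl_cartan_scale[OF X, of "- 1"] by (simp add: cartan_correction_eq[OF assms(2) X])
qed (rule cartan_correction_closed[OF assms(2)])

end
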